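(* Let $\mathbb{D}$ be $\mathbb{R}$, $\mathbb{C}$ or $\mathbb{H}$, and let $n$ be a positive integer. Every nilpotent element $X\in\mathfrak{gl}_n(\mathbb{D})$ is strongly real, i.e. there is $\tau\in\mathrm{GL}_n(\mathbb{D})$ with $\tau^2=\mathrm{Id}$ and $\tau X\tau^{-1}=-X$.
   Context: $\mathbb{H}$ denotes the real quaternions. $\mathfrak{gl}_n(\mathbb{D})$ is the Lie algebra of all $n\times n$ matrices over $\mathbb{D}$, the Lie algebra of $\mathrm{GL}_n(\mathbb{D})$. For a Lie group $G$ with Lie algebra $\mathfrak{g}$, $X\in\mathfrak{g}$ is called strongly real (strongly $\mathrm{Ad}_G$-real) if $-X=\mathrm{Ad}(\tau)X$ for some $\tau\in G$ with $\tau^2=\mathrm{Id}$. *)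

theory Defs
  imports Complex_Main "Jordan_Normal_Form.Matrix"
begin

section \<open>The real quaternions\<close>

text \<open>\<open>Quat a b c d\<close> stands for \<open>a + b i + c j + d k\<close>.\<close>

datatype quat = Quat (qRe: real) (qI: real) (qJ: real) (qK: real)

instantiation quat :: division_ring
begin

definition zero_quat :: quat where "0 = Quat 0 0 0 0"
definition one_quat :: quat where "1 = Quat 1 0 0 0"

definition plus_quat :: "quat \<Rightarrow> quat \<Rightarrow> quat" where
  "x + y = Quat (qRe x + qRe y) (qI x + qI y) (qJ x + qJ y) (qK x + qK y)"

definition uminus_quat :: "quat \<Rightarrow> quat" where
  "- x = Quat (- qRe x) (- qI x) (- qJ x) (- qK x)"

definition minus_quat :: "quat \<Rightarrow> quat \<Rightarrow> quat" where
  "x - y = Quat (qRe x - qRe y) (qI x - qI y) (qJ x - qJ y) (qK x - qK y)"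

definition times_quat :: "quat \<Rightarrow> quat \<Rightarrow> quat" where
  "x * y = Quat
    (qRe x * qRe y - qI x * qI y - qJ x * qJ y - qK x * qK y)
    (qRe x * qI y + qI x * qRe y + qJ x * qK y - qK x * qJ y)
    (qRe x * qJ y - qI x * qK y + qJ x * qRe y + qK x * qI y)
    (qRe x * qK y + qI x * qJ y - qJ x * qI y + qK x * qRe y)"

text \<open>The inverse is the conjugate divided by the squared norm.\<close>

definition inverse_quat :: "quat \<Rightarrow> quat" where
  "inverse x = (let N = (qRe x)\<^sup>2 + (qI x)\<^sup>2 + (qJ x)\<^sup>2 + (qK x)\<^sup>2
     in Quat (qRe x / N) (- qI x / N) (- qJ x / N) (- qK x / N))"

definition divide_quat :: "quat \<Rightarrow> quat \<Rightarrow> quat" where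
  "divide_quat x y = x * inverse y"

lemma quat_norm_nonzero:
  "x \<noteq> 0 \<Longrightarrow> (qRe x)\<^sup>2 + (qI x)\<^sup>2 + (qJ x)\<^sup>2 + (qK x)\<^sup>2 \<noteq> 0"
  by (cases x) (auto simp: zero_quat_def add_nonneg_eq_0_iff)

instance
proof
  fix x y z :: quat
  show "x * y * z = x * (y * z)"
    by (simp add: times_quat_def algebra_simps)
  show "x \<noteq> 0 \<Longrightarrow> inverse x * x = 1"
    using quat_norm_nonzero[of x]
    by (simp add: inverse_quat_def times_quat_def one_quat_def Let_def
        add_divide_distrib[symmetric] diff_divide_distrib[symmetric] power2_eq_square)
  show "x \<noteq> 0 \<Longrightarrow> x * inverse x = 1"
    using quat_norm_nonzero[of x]
    by (simp add: inverse_quat_def times_quat_def one_quat_def Let_def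
        add_divide_distrib[symmetric] diff_divide_distrib[symmetric] power2_eq_square)
qed (auto simp: zero_quat_def one_quat_def plus_quat_def uminus_quat_def minus_quat_def
      times_quat_def inverse_quat_def divide_quat_def algebra_simps intro: quat.expand)

end

lemma quat_relations:
  defines "i \<equiv> Quat 0 1 0 0" and "j \<equiv> Quat 0 0 1 0" and "k \<equiv> Quat 0 0 0 1"
  shows "i * i = - 1" and "j * j = - 1" and "k * k = - 1" and "i * j * k = - 1"
  by (simp_all add: i_def j_def k_def times_quat_def one_quat_def uminus_quat_def)


section \<open>General linear groups and strong reality\<close>

text \<open>The Lie algebra \<open>gl_n(D)\<close> has underlying set \<^term>\<open>carrier_mat n n\<close>. The inverse
  of a matrix is taken in the group \<open>GL_n(D)\<close>.\<close>

definition GL :: "nat \<Rightarrow> 'a::ring_1 mat monoid" where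
  "GL n = units_of (ring_mat TYPE('a) n ())"

definition Ad :: "nat \<Rightarrow> 'a::ring_1 mat \<Rightarrow> 'a mat \<Rightarrow> 'a mat" where
  "Ad n \<tau> X = \<tau> * X * inv\<^bsub>GL n\<^esub> \<tau>"

definition strongly_Ad_GL_real :: "nat \<Rightarrow> 'a::ring_1 mat \<Rightarrow> bool" where
  "strongly_Ad_GL_real n X \<longleftrightarrow>
     (\<exists>\<tau> \<in> carrier (GL n). \<tau> [^]\<^bsub>GL n\<^esub> (2::nat) = \<one>\<^bsub>GL n\<^esub> \<and> - X = Ad n \<tau> X)"

definition nilpotent_mat :: "'a::semiring_1 mat \<Rightarrow> bool" where
  "nilpotent_mat X \<longleftrightarrow> (\<exists>k. X ^\<^sub>m k = 0\<^sub>m (dim_row X) (dim_col X))"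

lemma group_GL: "group (GL n :: 'a::ring_1 mat monoid)"
proof -
  interpret semiring "ring_mat TYPE('a) n ()" by (rule semiring_mat)
  show ?thesis unfolding GL_def by (rule units_group)
qed

lemma GL_simps:
  "\<one>\<^bsub>GL n\<^esub> = 1\<^sub>m n"
  "mult (GL n) = (*)"
  "carrier (GL n :: 'a::ring_1 mat monoid) =
     {A \<in> carrier_mat n n. \<exists>B \<in> carrier_mat n n. B * A = 1\<^sub>m n \<and> A * B = 1\<^sub>m n}"
  by (simp_all add: GL_def units_of_def Units_def ring_mat_simps)

end

theory Submission
  imports Defs "HOL-Library.Function_Algebras"
begin

text \<open>
  The underlying fact holds for every nilpotent endomorphism \<open>X\<close> of a vector space \<open>V\<close> over a
  division ring: there is a decomposition \<open>V = A \<oplus> B\<close> with \<open>X A \<subseteq> B\<close> and \<open>X B \<subseteq> A\<close>, and then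
  \<open>\<tau> = 1\<close> on \<open>A\<close>, \<open>\<tau> = - 1\<close> on \<open>B\<close> is an involution anticommuting with \<open>X\<close>. By induction on the
  nilpotency index the image \<open>X V\<close> has such a decomposition \<open>A' \<oplus> B'\<close>. Its preimages
  \<open>A\<^sub>0 = X\<^sup>-\<^sup>1 B' \<supseteq> A'\<close> and \<open>B\<^sub>0 = X\<^sup>-\<^sup>1 A' \<supseteq> B'\<close> span \<open>V\<close> and meet in \<open>ker X\<close>; cutting them down by
  suitable complements makes the sum direct. Complements exist by Zorn's lemma.
\<close>

section \<open>Right vector spaces over a division ring: subspaces and complements\<close>

text \<open>Scalars act on the right because matrices will act on columns from the left: over a
  noncommutative division ring only these two actions commute.\<close>

locale right_vector_space =
  fixes scale :: "'v::ab_group_add \<Rightarrow> 'd::division_ring \<Rightarrow> 'v" (infixl "\<star>" 75)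
  assumes scale_add_left: "(u + v) \<star> c = u \<star> c + v \<star> c"
    and scale_add_right: "v \<star> (c + d) = v \<star> c + v \<star> d"
    and scale_scale: "v \<star> c \<star> d = v \<star> (c * d)"
    and scale_one: "v \<star> 1 = v"
begin

definition right_subspace :: "'v set \<Rightarrow> bool" where
  "right_subspace S \<longleftrightarrow>
     0 \<in> S \<and> (\<forall>u\<in>S. \<forall>v\<in>S. u + v \<in> S) \<and> (\<forall>v\<in>S. \<forall>c. v \<star> c \<in> S)"

definition right_linear :: "('v \<Rightarrow> 'v) \<Rightarrow> bool" where
  "right_linear f \<longleftrightarrow> (\<forall>u v. f (u + v) = f u + f v) \<and> (\<forall>v c. f (v \<star> c) = f v \<star> c)"

lemma scale_zero_left: "0 \<star> c = 0"
  using scale_add_left[of 0 0 c] by simp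

lemma scale_zero_right: "v \<star> 0 = 0"
  using scale_add_right[of v 0 0] by simp

lemma scale_minus_one: "v \<star> (- 1) = - v"
  using scale_add_right[of v 1 "- 1"] by (simp add: scale_zero_right scale_one eq_neg_iff_add_eq_0 add.commute)

lemma right_subspace_zero: "right_subspace S \<Longrightarrow> 0 \<in> S"
  and right_subspace_add: "right_subspace S \<Longrightarrow> u \<in> S \<Longrightarrow> v \<in> S \<Longrightarrow> u + v \<in> S"
  and right_subspace_scale: "right_subspace S \<Longrightarrow> v \<in> S \<Longrightarrow> v \<star> c \<in> S"
  by (auto simp: right_subspace_def)

lemma right_subspace_uminus: "right_subspace S \<Longrightarrow> v \<in> S \<Longrightarrow> - v \<in> S"
  using right_subspace_scale[of S v "- 1"] by (simp add: scale_minus_one)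

lemma right_subspace_diff: "right_subspace S \<Longrightarrow> u \<in> S \<Longrightarrow> v \<in> S \<Longrightarrow> u - v \<in> S"
  using right_subspace_add[of S u "- v"] right_subspace_uminus by simp

lemma right_subspace_sum:
  "right_subspace S \<Longrightarrow> (\<And>i. i \<in> I \<Longrightarrow> f i \<in> S) \<Longrightarrow> sum f I \<in> S"
  by (induction I rule: infinite_finite_induct)
    (auto simp: right_subspace_zero right_subspace_add)

lemma right_subspace_singleton_zero: "right_subspace {0}"
  by (auto simp: right_subspace_def scale_zero_left)

lemma right_subspace_Int:
  "right_subspace S \<Longrightarrow> right_subspace T \<Longrightarrow> right_subspace (S \<inter> T)"
  by (auto simp: right_subspace_def)

text \<open>Enlarges a subspace by one vector; in \<open>complement_containing\<close> this
  contradicts maximality.\<close>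

lemma right_subspace_span_insert:
  assumes "right_subspace S"
  shows "right_subspace {s + u \<star> c | s c. s \<in> S}"
  unfolding right_subspace_def
proof (intro conjI ballI allI)
  show "0 \<in> {s + u \<star> c |s c. s \<in> S}"
    using right_subspace_zero[OF assms] scale_zero_right[of u] by force
next
  fix x y assume "x \<in> {s + u \<star> c |s c. s \<in> S}" "y \<in> {s + u \<star> c |s c. s \<in> S}"
  then obtain s c t d where "x = s + u \<star> c" "s \<in> S" "y = t + u \<star> d" "t \<in> S" by blast
  then have "x + y = (s + t) + u \<star> (c + d)" "s + t \<in> S"
    using right_subspace_add[OF assms] by (auto simp: scale_add_right algebra_simps)
  then show "x + y \<in> {s + u \<star> c |s c. s \<in> S}" by blast
next
  fix x d assume "x \<in> {s + u \<star> c |s c. s \<in> S}"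
  then obtain s c where "x = s + u \<star> c" "s \<in> S" by blast
  then have "x \<star> d = s \<star> d + u \<star> (c * d)" "s \<star> d \<in> S"
    using right_subspace_scale[OF assms] by (auto simp: scale_add_left scale_scale)
  then show "x \<star> d \<in> {s + u \<star> c |s c. s \<in> S}" by blast
qed

lemma right_subspace_plus:
  assumes "right_subspace S" "right_subspace T"
  shows "right_subspace {s + t | s t. s \<in> S \<and> t \<in> T}"
  unfolding right_subspace_def
proof (intro conjI ballI allI)
  show "0 \<in> {s + t | s t. s \<in> S \<and> t \<in> T}"
    using assms[THEN right_subspace_zero] by force
next
  fix x y assume "x \<in> {s + t | s t. s \<in> S \<and> t \<in> T}" "y \<in> {s + t | s t. s \<in> S \<and> t \<in> T}"
  then obtain s t s' t' where *: "x = s + t" "y = s' + t'" "s \<in> S" "t \<in> T" "s' \<in> S" "t' \<in> T"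
    by blast
  then have "x + y = (s + s') + (t + t')" by (simp add: algebra_simps)
  then show "x + y \<in> {s + t | s t. s \<in> S \<and> t \<in> T}"
    using * assms[THEN right_subspace_add] by blast
next
  fix x c assume "x \<in> {s + t | s t. s \<in> S \<and> t \<in> T}"
  then show "x \<star> c \<in> {s + t | s t. s \<in> S \<and> t \<in> T}"
    using assms[THEN right_subspace_scale] by (force simp: scale_add_left)
qed

text \<open>Supplies the upper bound for Zorn's lemma. Two vectors of the union already lie in one
  common member, since a chain is totally ordered by inclusion.\<close>

lemma right_subspace_Union_chain:
  assumes "C \<noteq> {}" "subset.chain {S. right_subspace S} C"
  shows "right_subspace (\<Union>C)"
proof -
  have sub: "right_subspace S" if "S \<in> C" for S
    using assms that by (auto simp: subset.chain_def)
  have "u + v \<in> \<Union>C" if uv: "u \<in> \<Union>C" "v \<in> \<Union>C" for u v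
  proof -
    obtain S T where ST: "S \<in> C" "T \<in> C" "u \<in> S" "v \<in> T" using uv by blast
    have "S \<subseteq> T \<or> T \<subseteq> S" using assms(2) ST by (auto simp: subset.chain_def)
    then show ?thesis using ST sub right_subspace_add by blast
  qed
  moreover have "0 \<in> \<Union>C" using assms(1) sub right_subspace_zero by blast
  ultimately show ?thesis
    using sub right_subspace_scale unfolding right_subspace_def by blast
qed

text \<open>Zorn's lemma gives a maximal \<open>A\<close> among the subspaces between
  \<open>P\<close> and \<open>U\<close> that meet \<open>Q\<close> trivially. If some
  \<open>u\<close> in \<open>U\<close> were outside \<open>A + Q\<close>, adjoining \<open>u\<close>
  to \<open>A\<close> would keep the intersection with \<open>Q\<close> trivial, against
  maximality.\<close>

lemma complement_containing:
  assumes P: "right_subspace P" and Q: "right_subspace Q" and U: "right_subspace U"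
    and "P \<subseteq> U" "Q \<subseteq> U" and PQ: "P \<inter> Q \<subseteq> {0}"
  obtains A where "right_subspace A" "P \<subseteq> A" "A \<subseteq> U" "A \<inter> Q \<subseteq> {0}"
    "\<forall>u\<in>U. \<exists>a\<in>A. \<exists>q\<in>Q. u = a + q"
proof -
  define F where "F = {A. right_subspace A \<and> P \<subseteq> A \<and> A \<subseteq> U \<and> A \<inter> Q \<subseteq> {0}}"
  have "\<exists>M\<in>F. \<forall>S\<in>F. M \<subseteq> S \<longrightarrow> S = M"
  proof (rule subset_Zorn_nonempty)
    show "F \<noteq> {}" using assms by (auto simp: F_def)
  next
    fix C assume C: "C \<noteq> {}" "subset.chain F C"
    then have "C \<subseteq> F" by (auto simp: subset.chain_def)
    moreover have "right_subspace (\<Union>C)"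
      using C by (intro right_subspace_Union_chain) (auto simp: subset.chain_def F_def)
    ultimately show "\<Union>C \<in> F" using C(1) unfolding F_def by blast
  qed
  then obtain A where A: "A \<in> F" and max: "\<And>S. S \<in> F \<Longrightarrow> A \<subseteq> S \<Longrightarrow> S = A" by blast
  have sub: "right_subspace A" "P \<subseteq> A" "A \<subseteq> U" "A \<inter> Q \<subseteq> {0}" using A by (auto simp: F_def)
  have "\<exists>a\<in>A. \<exists>q\<in>Q. u = a + q" if u: "u \<in> U" for u
  proof (rule ccontr)
    assume no: "\<not> ?thesis"
    let ?S = "{s + u \<star> c | s c. s \<in> A}"
    have "A \<subseteq> ?S"
      using scale_zero_right[of u] by force
    moreover have "u \<in> ?S"
      unfolding mem_Collect_eq using right_subspace_zero[OF sub(1)] scale_one[of u]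
      by (intro exI[of _ 0] exI[of _ 1]) simp
    moreover have "u \<notin> A"
      using no right_subspace_zero[OF Q] by force
    moreover have "?S \<in> F"
    proof -
      have "?S \<subseteq> U"
        using sub(3) u right_subspace_add[OF U] right_subspace_scale[OF U] by blast
      moreover have "?S \<inter> Q \<subseteq> {0}"
      proof
        fix x assume "x \<in> ?S \<inter> Q"
        then obtain s c where x: "x = s + u \<star> c" "s \<in> A" "x \<in> Q" by blast
        \<comment> \<open>Otherwise dividing by \<open>c\<close> writes \<open>u\<close> as
          \<open>- s\<close> times \<open>inverse c\<close>, in \<open>A\<close>, plus
          \<open>x\<close> times \<open>inverse c\<close>, in \<open>Q\<close>, which
          \<open>no\<close> forbids.\<close>
        have "c = 0"
        proof (rule ccontr)
          assume "c \<noteq> 0"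
          then have "u = (u \<star> c) \<star> inverse c" by (simp add: scale_scale scale_one)
          also have "u \<star> c = x + - s" using x by simp
          finally have "u = (- s) \<star> inverse c + x \<star> inverse c"
            by (simp only: scale_add_left add.commute)
          then show False
            using no x sub(1) Q by (blast intro: right_subspace_scale right_subspace_uminus)
        qed
        then show "x \<in> {0}" using x sub(4) scale_zero_right by auto
      qed
      ultimately show ?thesis
        using right_subspace_span_insert[OF sub(1)] sub(2) \<open>A \<subseteq> ?S\<close> unfolding F_def by blast
    qed
    ultimately show False using max[of ?S] by blast
  qed
  then show ?thesis using that sub by blast
qed

section \<open>Linear maps and the decomposition swapped by a nilpotent map\<close>

lemma right_linear_zero: "right_linear f \<Longrightarrow> f 0 = 0"
  by (metis add_cancel_left_right right_linear_def)

lemma right_linear_add: "right_linear f \<Longrightarrow> f (u + v) = f u + f v"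
  and right_linear_scale: "right_linear f \<Longrightarrow> f (v \<star> c) = f v \<star> c"
  by (simp_all add: right_linear_def)

lemma right_linear_diff: "right_linear f \<Longrightarrow> f (u - v) = f u - f v"
  using right_linear_add[of f "u - v" v] by simp

lemma right_subspace_preimage:
  "right_linear f \<Longrightarrow> right_subspace V \<Longrightarrow> right_subspace S \<Longrightarrow> right_subspace {v \<in> V. f v \<in> S}"
  by (auto simp: right_subspace_def right_linear_zero right_linear_add right_linear_scale)

lemma right_subspace_image:
  assumes "right_linear f" "right_subspace V"
  shows "right_subspace (f ` V)"
  unfolding right_subspace_def
proof (intro conjI ballI allI)
  show "0 \<in> f ` V"
    using right_linear_zero[OF assms(1)] right_subspace_zero[OF assms(2)] by force
next
  fix x y assume "x \<in> f ` V" "y \<in> f ` V"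
  then show "x + y \<in> f ` V"
    using right_subspace_add[OF assms(2)]
    by (auto simp: right_linear_add[OF assms(1), symmetric])
next
  fix x c assume "x \<in> f ` V"
  then show "x \<star> c \<in> f ` V"
    using right_subspace_scale[OF assms(2)]
    by (auto simp: right_linear_scale[OF assms(1), symmetric])
qed

lemma nilpotent_swaps_decomposition:
  assumes f: "right_linear f" and V: "right_subspace V" and "f ` V \<subseteq> V"
    and "\<forall>v\<in>V. (f ^^ k) v = 0"
  shows "\<exists>A B. right_subspace A \<and> right_subspace B \<and> A \<subseteq> V \<and> B \<subseteq> V \<and> A \<inter> B \<subseteq> {0} \<and>
    (\<forall>v\<in>V. \<exists>a\<in>A. \<exists>b\<in>B. v = a + b) \<and> f ` A \<subseteq> B \<and> f ` B \<subseteq> A"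
  using assms(2-)
proof (induction k arbitrary: V)
  case 0
  then have "V = {0}" using right_subspace_zero by auto
  then show ?case
    using right_subspace_singleton_zero right_linear_zero[OF f]
    by (intro exI[of _ "{0}"]) auto
next
  case (Suc k)
  note V = \<open>right_subspace V\<close>
  have "\<forall>w\<in>f ` V. (f ^^ k) w = 0"
    using Suc.prems(3) by (auto simp: funpow_swap1)
  moreover have "f ` f ` V \<subseteq> f ` V" using Suc.prems(2) by blast
  ultimately obtain A' B' where
    A': "right_subspace A'" and B': "right_subspace B'" and "A' \<subseteq> f ` V" "B' \<subseteq> f ` V"
    and A'B': "A' \<inter> B' \<subseteq> {0}" and decomp': "\<And>w. w \<in> f ` V \<Longrightarrow> \<exists>a\<in>A'. \<exists>b\<in>B'. w = a + b"
    and swap': "f ` A' \<subseteq> B'" "f ` B' \<subseteq> A'"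
    using Suc.IH[OF right_subspace_image[OF f V]] by metis
  then have A'V: "A' \<subseteq> V" and B'V: "B' \<subseteq> V" using Suc.prems(2) by auto
  \<comment> \<open>\<open>N\<close> is the kernel of \<open>f\<close> on \<open>V\<close>, written
    as a preimage like the other two. It is the overlap of \<open>A0\<close> and \<open>B0\<close>,
    because \<open>A'\<close> and \<open>B'\<close> meet only in 0.\<close>
  define N where "N = {v \<in> V. f v \<in> {0}}"
  define A0 where "A0 = {v \<in> V. f v \<in> B'}"
  define B0 where "B0 = {v \<in> V. f v \<in> A'}"
  have N: "right_subspace N" and A0: "right_subspace A0" and B0: "right_subspace B0"
    unfolding N_def A0_def B0_def
    using right_subspace_preimage[OF f V] A' B' right_subspace_singleton_zero by blast+
  have NA0: "N \<subseteq> A0" and NB0: "N \<subseteq> B0"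
    using A'[THEN right_subspace_zero] B'[THEN right_subspace_zero]
    by (auto simp: N_def A0_def B0_def)
  have A'A0: "A' \<subseteq> A0" and B'B0: "B' \<subseteq> B0"
    using swap' A'V B'V by (auto simp: A0_def B0_def)
  let ?A'N = "A' \<inter> N" and ?B'N = "B' \<inter> N"
  have A'N: "right_subspace ?A'N" and B'N: "right_subspace ?B'N"
    using A' B' N by (auto intro: right_subspace_Int)
  \<comment> \<open>The overlap \<open>N\<close> has to be shared out. With \<open>K\<close> a
    complement of \<open>?S\<close> in \<open>N\<close>, the piece \<open>?A'N\<close> is assigned
    to \<open>A\<close>, while \<open>?B'N\<close> and \<open>K\<close> are assigned to
    \<open>B\<close>.\<close>
  let ?S = "{s + t | s t. s \<in> ?B'N \<and> t \<in> ?A'N}"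
  have "{0} \<subseteq> N" using right_subspace_zero[OF N] by simp
  moreover have "?S \<subseteq> N" using right_subspace_add[OF N] by blast
  moreover have "{0} \<inter> ?S \<subseteq> {0}" by simp
  ultimately obtain K where K: "right_subspace K" "{0} \<subseteq> K" "K \<subseteq> N" "K \<inter> ?S \<subseteq> {0}"
    and KN: "\<forall>u\<in>N. \<exists>k\<in>K. \<exists>s\<in>?S. u = k + s"
    by (rule complement_containing[OF right_subspace_singleton_zero
        right_subspace_plus[OF B'N A'N] N]) (rule that)
  let ?BK = "{b + k | b k. b \<in> ?B'N \<and> k \<in> K}"
  have BK: "right_subspace ?BK" by (rule right_subspace_plus[OF B'N K(1)])
  have "?BK \<subseteq> N" using K right_subspace_add[OF N] by blast
  \<comment> \<open>Here \<open>b\<close> is a difference of kernel vectors, so \<open>k\<close>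
    lies in \<open>?S\<close> as well as in \<open>K\<close> and vanishes; then \<open>b\<close>
    lies in both \<open>A'\<close> and \<open>B'\<close>. This makes both of the following
    complements possible.\<close>
  have indep: "b = 0 \<and> k = 0" if "b \<in> B'" "k \<in> K" "b + k \<in> ?A'N" for b k
  proof -
    define a where "a = b + k"
    have a: "a \<in> ?A'N" using that by (simp add: a_def)
    have b: "b = a - k" by (simp add: a_def)
    have "b \<in> N" unfolding b using a K(3) \<open>k \<in> K\<close> right_subspace_diff[OF N] by blast
    moreover have k: "k = - b + a" by (simp add: a_def)
    ultimately have "k \<in> ?S"
      using a \<open>b \<in> B'\<close> right_subspace_uminus[OF B'N] by blast
    then have "k = 0" using K(4) \<open>k \<in> K\<close> by blast
    then show ?thesis using that A'B' by auto
  qed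
  have "?BK \<subseteq> A0" using \<open>?BK \<subseteq> N\<close> NA0 by blast
  moreover have "A' \<inter> ?BK \<subseteq> {0}"
  proof
    fix x assume "x \<in> A' \<inter> ?BK"
    then obtain b k where "x = b + k" "b \<in> B'" "k \<in> K" "x \<in> A'" "x \<in> N"
      using \<open>?BK \<subseteq> N\<close> by blast
    then show "x \<in> {0}" using indep[of b k] by auto
  qed
  \<comment> \<open>\<open>A\<close> omits exactly the kernel vectors reserved for \<open>B\<close>:
    it complements \<open>?BK\<close> in \<open>A0\<close>.\<close>
  ultimately obtain A where A: "right_subspace A" "A' \<subseteq> A" "A \<subseteq> A0" "A \<inter> ?BK \<subseteq> {0}"
    and A_dec: "\<forall>u\<in>A0. \<exists>a\<in>A. \<exists>q\<in>?BK. u = a + q"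
    by (rule complement_containing[OF A' BK A0 A'A0]) (rule that)
  let ?B'K = "{b + k | b k. b \<in> B' \<and> k \<in> K}"
  have B'K: "right_subspace ?B'K" by (rule right_subspace_plus[OF B' K(1)])
  have "?B'K \<subseteq> B0" using B'B0 K(3) NB0 right_subspace_add[OF B0] by blast
  moreover have "?A'N \<subseteq> B0" using NB0 by blast
  moreover have "?B'K \<inter> ?A'N \<subseteq> {0}"
  proof
    fix x assume "x \<in> ?B'K \<inter> ?A'N"
    then obtain b k where "x = b + k" "b \<in> B'" "k \<in> K" "x \<in> ?A'N" by blast
    then show "x \<in> {0}" using indep[of b k] by auto
  qed
  \<comment> \<open>Symmetrically, \<open>B\<close> complements \<open>?A'N\<close> in
    \<open>B0\<close>, but it must also absorb \<open>K\<close>.\<close>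
  ultimately obtain B where B: "right_subspace B" "?B'K \<subseteq> B" "B \<subseteq> B0" "B \<inter> ?A'N \<subseteq> {0}"
    and B_dec: "\<forall>u\<in>B0. \<exists>b\<in>B. \<exists>q\<in>?A'N. u = b + q"
    by (rule complement_containing[OF B'K A'N B0]) (rule that)
  have "B' \<subseteq> B"
  proof
    fix b assume "b \<in> B'"
    moreover have "b = b + 0" by simp
    ultimately show "b \<in> B" using B(2) right_subspace_zero[OF K(1)] by blast
  qed
  \<comment> \<open>A common vector is killed by \<open>f\<close>, so it splits along
    \<open>N\<close>. Removing its part \<open>a\<close> leaves a vector of both \<open>A\<close>
    and \<open>?BK\<close>, hence 0; what remains is in \<open>?A'N\<close>, which meets
    \<open>B\<close> trivially.\<close>
  have "A \<inter> B \<subseteq> {0}"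
  proof
    fix x assume x: "x \<in> A \<inter> B"
    then have "f x = 0" using A(3) B(3) A'B' by (auto simp: A0_def B0_def)
    then have "x \<in> N" using x A(3) by (auto simp: N_def A0_def)
    then obtain k b a where kba: "k \<in> K" "b \<in> ?B'N" "a \<in> ?A'N" "x = k + (b + a)"
      using KN by blast
    have "x - a = b + k" using kba by (simp add: algebra_simps)
    moreover have "x - a \<in> A" using x kba A(2) right_subspace_diff[OF A(1)] by blast
    ultimately have "x - a = 0" using A(4) kba by blast
    then have "x \<in> ?A'N" using kba(3) by (simp only: right_minus_eq)
    then show "x \<in> {0}" using x B(4) by blast
  qed
  moreover have "\<exists>a\<in>A. \<exists>b\<in>B. v = a + b" if v: "v \<in> V" for v
  proof -
    obtain a' b' where "a' \<in> A'" "b' \<in> B'" and fv: "f v = a' + b'" using decomp' v by blast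
    \<comment> \<open>Lifting the \<open>B'\<close> part of \<open>f v\<close> to \<open>w\<close>
      puts \<open>w\<close> into \<open>A0\<close> and leaves \<open>v - w\<close> in
      \<open>B0\<close>.\<close>
    obtain w where w: "w \<in> V" "f w = b'" using \<open>B' \<subseteq> f ` V\<close> \<open>b' \<in> B'\<close> by blast
    have "w \<in> A0" using w \<open>b' \<in> B'\<close> by (auto simp: A0_def)
    moreover have "v - w \<in> B0"
      using w \<open>a' \<in> A'\<close> fv v right_subspace_diff[OF V]
      by (auto simp: B0_def right_linear_diff[OF f])
    ultimately have "\<exists>a\<in>A. \<exists>q\<in>?BK. w = a + q" "\<exists>b\<in>B. \<exists>r\<in>?A'N. v - w = b + r"
      by (simp_all only: A_dec[rule_format] B_dec[rule_format])
    then obtain a q b r where *: "a \<in> A" "q \<in> ?BK" "w = a + q" "b \<in> B" "r \<in> ?A'N" "v - w = b + r"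
      by (elim bexE)
    \<comment> \<open>The correction terms change sides: \<open>q\<close> belongs to
      \<open>?BK\<close>, hence to \<open>B\<close>, and \<open>r\<close> to \<open>A'\<close>,
      hence to \<open>A\<close>.\<close>
    have "v = (a + r) + (q + b)"
      using arg_cong2[OF *(3,6), of "(+)"] by (simp add: ac_simps)
    moreover have "a + r \<in> A" using * A(2) right_subspace_add[OF A(1)] by blast
    moreover have "q + b \<in> B" using * B(2) right_subspace_add[OF B(1)] by blast
    ultimately show ?thesis by blast
  qed
  moreover have "f ` A \<subseteq> B" using A(3) \<open>B' \<subseteq> B\<close> by (auto simp: A0_def)
  moreover have "f ` B \<subseteq> A" using B(3) A(2) by (auto simp: B0_def)
  moreover have "A \<subseteq> V" "B \<subseteq> V" using A(3) B(3) by (auto simp: A0_def B0_def)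
  ultimately show ?case using A(1) B(1) by blast
qed

end

section \<open>Matrices acting on columns\<close>

interpretation column: right_vector_space "\<lambda>(v :: nat \<Rightarrow> 'a::division_ring) c i. v i * c"
  by unfold_locales (auto simp: fun_eq_iff algebra_simps)

text \<open>Column vectors are functions vanishing from index \<open>n\<close> on, because a type of functions is an
  additive group while \<^typ>\<open>'a vec\<close> is not.\<close>

definition column_of :: "'a::zero mat \<Rightarrow> nat \<Rightarrow> nat \<Rightarrow> 'a" where
  "column_of M j = (\<lambda>i. if i < dim_row M then M $$ (i, j) else 0)"

definition mat_apply :: "'a::semiring_0 mat \<Rightarrow> (nat \<Rightarrow> 'a) \<Rightarrow> nat \<Rightarrow> 'a" where
  "mat_apply M v = (\<lambda>i. if i < dim_row M then \<Sum>j<dim_col M. M $$ (i, j) * v j else 0)"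

lemma right_linear_mat_apply: "column.right_linear (mat_apply (M :: 'a::division_ring mat))"
  unfolding column.right_linear_def mat_apply_def
  by (auto simp: fun_eq_iff algebra_simps sum.distrib sum_distrib_left sum_distrib_right)

lemma sum_fun_at: "(\<Sum>k\<in>K. f k) i = (\<Sum>k\<in>K. f k i)"
  by (induction K rule: infinite_finite_induct) auto

text \<open>The first form carries the swapping of subspaces over to left multiplication by
  \<open>X\<close>. The second, a combination of columns with scalars on the right, shows that
  having all columns in a given right subspace survives right multiplication.\<close>

lemma column_of_mult:
  assumes "M \<in> carrier_mat n n" "N \<in> carrier_mat n n" "j < n"
  shows "column_of (M * N) j = mat_apply M (column_of N j)"
    and "column_of (M * N) j = (\<Sum>k<n. (\<lambda>i. column_of M k i * N $$ (k, j)))"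
  using assms
  by (auto simp: column_of_def mat_apply_def fun_eq_iff scalar_prod_def lessThan_atLeast0
      sum_fun_at intro!: sum.cong)

lemma mat_apply_mult:
  assumes "M \<in> carrier_mat n n" "N \<in> carrier_mat n n"
  shows "mat_apply (M * N) v = mat_apply M (mat_apply N (v :: nat \<Rightarrow> 'a::semiring_0))"
proof
  fix i
  have "(\<Sum>j<n. (\<Sum>k<n. M $$ (i, k) * N $$ (k, j)) * v j) =
      (\<Sum>k<n. M $$ (i, k) * (\<Sum>j<n. N $$ (k, j) * v j))"
    by (simp add: sum_distrib_left sum_distrib_right mult.assoc) (rule sum.swap)
  then show "mat_apply (M * N) v i = mat_apply M (mat_apply N v) i"
    using assms
    by (simp add: mat_apply_def scalar_prod_def lessThan_atLeast0)
qed

text \<open>Vanishing from \<open>n\<close> on matters at exponent 0: the identity matrix truncates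
  \<open>v\<close>, whereas the empty iterate returns it unchanged. Matrix powers split off a factor
  on the right, so \<open>v\<close> varies in the induction.\<close>

lemma mat_apply_pow:
  assumes "M \<in> carrier_mat n n" "\<And>i. i \<ge> n \<Longrightarrow> v i = 0"
  shows "mat_apply (M ^\<^sub>m k) v = (mat_apply M ^^ k) (v :: nat \<Rightarrow> 'a::semiring_1)"
  using assms(2)
proof (induction k arbitrary: v)
  case 0
  have "(\<Sum>j<n. (if i = j then 1 else 0) * v j) = v i" if "i < n" for i
    using that by (simp add: if_distrib[of "\<lambda>x. x * _"] cong: if_cong)
  then show ?case
    using 0 assms(1) by (auto simp: mat_apply_def fun_eq_iff)
next
  case (Suc k)
  have "mat_apply (M ^\<^sub>m Suc k) v = mat_apply (M ^\<^sub>m k) (mat_apply M v)"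
    using assms(1) by (simp add: mat_apply_mult[where n=n])
  also have "\<dots> = (mat_apply M ^^ k) (mat_apply M v)"
    using assms(1) by (intro Suc.IH) (auto simp: mat_apply_def)
  finally show ?case by (simp add: funpow_swap1)
qed

text \<open>The involution is \<open>E - F\<close>, where \<open>E\<close> and \<open>F\<close> are
  the projections onto the two summands. Their algebra comes from one principle: a matrix splits in
  at most one way into a part with columns in \<open>A\<close> and a part with columns in
  \<open>B\<close>.\<close>

lemma nilpotent_mat_anticommuting_involution:
  fixes X :: "'a::division_ring mat"
  assumes X: "X \<in> carrier_mat n n" and nil: "nilpotent_mat X"
  obtains T where "T \<in> carrier_mat n n" "T * T = 1\<^sub>m n" "T * X = - (X * T)"
proof -
  define V where "V = {v :: nat \<Rightarrow> 'a. \<forall>i\<ge>n. v i = 0}"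
  obtain k where k: "X ^\<^sub>m k = 0\<^sub>m n n" using nil X by (auto simp: nilpotent_mat_def)
  have pow: "\<forall>v\<in>V. (mat_apply X ^^ k) v = 0"
  proof
    fix v assume "v \<in> V"
    then have "(mat_apply X ^^ k) v = mat_apply (0\<^sub>m n n) v"
      using mat_apply_pow[OF X, of v k] k by (simp add: V_def)
    then show "(mat_apply X ^^ k) v = 0" by (simp add: mat_apply_def fun_eq_iff)
  qed
  have V: "column.right_subspace V"
    by (auto simp: V_def column.right_subspace_def)
  have XV: "mat_apply X ` V \<subseteq> V"
    using X by (auto simp: V_def mat_apply_def)
  obtain A B where A: "column.right_subspace A" and B: "column.right_subspace B"
    and "A \<subseteq> V" "B \<subseteq> V" and AB: "A \<inter> B \<subseteq> {0}"
    and decomp: "\<forall>v\<in>V. \<exists>a\<in>A. \<exists>b\<in>B. v = a + b"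
    and swap: "mat_apply X ` A \<subseteq> B" "mat_apply X ` B \<subseteq> A"
    using column.nilpotent_swaps_decomposition[OF right_linear_mat_apply V XV pow]
    by (elim exE conjE) (rule that)
  \<comment> \<open>For a right subspace \<open>S\<close> this is a right ideal of the matrix ring,
    as \<open>cols_diff\<close> and \<open>cols_mult\<close> show.\<close>
  define cols where "cols S = {M \<in> carrier_mat n n. \<forall>j<n. column_of M j \<in> S}" for S :: "(nat \<Rightarrow> 'a) set"
  have cols_carrier: "M \<in> carrier_mat n n" if "M \<in> cols S" for M S
    using that by (simp add: cols_def)
  have cols_diff: "M - N \<in> cols S" if "column.right_subspace S" "M \<in> cols S" "N \<in> cols S" for M N S
  proof -
    have "column_of (M - N) j = column_of M j - column_of N j" if "j < n" for j
      using \<open>j < n\<close> \<open>M \<in> cols S\<close> \<open>N \<in> cols S\<close> by (auto simp: cols_def column_of_def fun_eq_iff)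
    then show ?thesis using that by (auto simp: cols_def column.right_subspace_diff)
  qed
  have cols_mult: "M * N \<in> cols S"
    if "column.right_subspace S" "M \<in> cols S" "N \<in> carrier_mat n n" for M N S
    using that unfolding cols_def
    by (auto simp: column_of_mult(2)[where n=n] intro!: column.right_subspace_sum column.right_subspace_scale)
  have cols_swap: "X * M \<in> cols B" if "M \<in> cols A" for M
    using that swap X by (auto simp: cols_def column_of_mult(1)[where n=n])
  have cols_swap': "X * M \<in> cols A" if "M \<in> cols B" for M
    using that swap X by (auto simp: cols_def column_of_mult(1)[where n=n])
  have cols_Int: "M = 0\<^sub>m n n" if "M \<in> cols A" "M \<in> cols B" for M
  proof (rule eq_matI)
    fix i j assume ij: "i < dim_row (0\<^sub>m n n)" "j < dim_col (0\<^sub>m n n)"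
    then have "column_of M j = 0" using that AB by (auto simp: cols_def)
    then have "column_of M j i = 0" by simp
    then show "M $$ (i, j) = 0\<^sub>m n n $$ (i, j)"
      using ij that by (auto simp: column_of_def cols_def)
  qed (use that in \<open>auto simp: cols_def\<close>)
  have "column_of (1\<^sub>m n) j \<in> V" for j :: nat by (auto simp: V_def column_of_def)
  then have "\<forall>j. \<exists>a b. a \<in> A \<and> b \<in> B \<and> column_of (1\<^sub>m n) j = a + b"
    using decomp by (meson bspec)
  then obtain a b where ab: "\<forall>j. a j \<in> A \<and> b j \<in> B \<and> column_of (1\<^sub>m n) j = a j + b j"
    unfolding choice_iff by (elim exE) (rule that)
  \<comment> \<open>The columns of \<open>E\<close> and \<open>F\<close> are the components in
    \<open>A\<close> and \<open>B\<close> of the standard basis vectors.\<close>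
  define E where "E = mat n n (\<lambda>(i, j). a j i)"
  define F where "F = mat n n (\<lambda>(i, j). b j i)"
  have "a j \<in> V" "b j \<in> V" for j using ab \<open>A \<subseteq> V\<close> \<open>B \<subseteq> V\<close> by blast+
  then have colE: "column_of E j = a j" and colF: "column_of F j = b j" if "j < n" for j
    using that by (auto simp: E_def F_def column_of_def fun_eq_iff V_def)
  have EA: "E \<in> cols A" and FB: "F \<in> cols B"
    using ab colE colF by (auto simp: cols_def E_def F_def)
  note EF[simp] = cols_carrier[OF EA] cols_carrier[OF FB]
  have one: "1\<^sub>m n = E + F"
  proof (rule eq_matI)
    fix i j assume "i < dim_row (E + F)" "j < dim_col (E + F)"
    then show "1\<^sub>m n $$ (i, j) = (E + F) $$ (i, j)"
      using fun_cong[OF ab[THEN spec, of j, THEN conjunct2, THEN conjunct2], of i] by (auto simp: column_of_def E_def F_def)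
  qed (auto simp: E_def F_def)
  \<comment> \<open>\<open>P - P'\<close> equals \<open>Q' - Q\<close>, so its columns lie in both
    \<open>A\<close> and \<open>B\<close>.\<close>
  have unique: "P = P' \<and> Q = Q'"
    if eq: "P + Q = P' + Q'" and P: "P \<in> cols A" "P' \<in> cols A" and Q: "Q \<in> cols B" "Q' \<in> cols B"
    for P Q P' Q'
  proof -
    note carr = P[THEN cols_carrier] Q[THEN cols_carrier]
    have entry: "P $$ (i, j) + Q $$ (i, j) = P' $$ (i, j) + Q' $$ (i, j)" if "i < n" "j < n" for i j
      using arg_cong[OF eq, of "\<lambda>M. M $$ (i, j)"] that carr by simp
    then have "P $$ (i, j) - P' $$ (i, j) = Q' $$ (i, j) - Q $$ (i, j)" if "i < n" "j < n" for i j
      using that by (simp add: diff_eq_eq add_diff_eq diff_add_eq eq_diff_eq add.commute)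
    then have "P - P' = Q' - Q" using carr by (intro eq_matI) auto
    then have 0: "P - P' = 0\<^sub>m n n"
      using cols_Int cols_diff[OF A P] cols_diff[OF B Q(2,1)] by simp
    have "P $$ (i, j) = P' $$ (i, j)" if "i < n" "j < n" for i j
      using arg_cong[OF 0, of "\<lambda>M. M $$ (i, j)"] that carr by simp
    moreover from this have "Q $$ (i, j) = Q' $$ (i, j)" if "i < n" "j < n" for i j
      using that entry[OF that] by simp
    ultimately show ?thesis using carr by (auto intro!: eq_matI)
  qed
  have split: "E * M + F * M = M" "M * E + M * F = M" if "M \<in> carrier_mat n n" for M
    using that add_mult_distrib_mat[OF EF that] mult_add_distrib_mat[OF that EF] one[symmetric]
    by simp_all
  note carrier[simp] = X mult_carrier_mat[of _ n n _ n] minus_carrier_mat[of _ n n]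
  have zero: "0\<^sub>m n n \<in> cols A" "0\<^sub>m n n \<in> cols B"
    using cols_diff[OF A EA EA] cols_diff[OF B FB FB] EF[THEN minus_r_inv_mat] by simp_all
  \<comment> \<open>Both sides equal \<open>X\<close>. Since \<open>X\<close> swaps the summands,
    \<open>X * F\<close> has columns in \<open>A\<close> and \<open>X * E\<close> in
    \<open>B\<close>, so uniqueness pairs them with \<open>E * X\<close> and
    \<open>F * X\<close>.\<close>
  have "E * X + F * X = X * F + X * E"
    using split[OF X] comm_add_mat[of "X * E" n n "X * F"] by simp
  then have EX: "E * X = X * F" and FX: "F * X = X * E"
    using unique cols_mult[OF A EA X] cols_mult[OF B FB X] cols_swap[OF EA] cols_swap'[OF FB]
    by blast+
  \<comment> \<open>Comparing two splittings of \<open>E\<close>, and below of \<open>F\<close>,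
    yields idempotence and orthogonality.\<close>
  have "E * E + F * E = E + 0\<^sub>m n n" using split(1)[of E] by simp
  then have EE: "E * E = E" and FE: "F * E = 0\<^sub>m n n"
    using unique cols_mult[OF A EA EF(1)] cols_mult[OF B FB EF(1)] EA zero(2) by blast+
  have "E * F + F * F = 0\<^sub>m n n + F" using split(1)[of F] by simp
  then have EF0: "E * F = 0\<^sub>m n n" and FF: "F * F = F"
    using unique cols_mult[OF A EA EF(2)] cols_mult[OF B FB EF(2)] FB zero(1) by blast+
  show ?thesis
  proof
    show "E - F \<in> carrier_mat n n" by simp
    have "(E - F) * (E - F) = (E * E - F * E) - (E * F - F * F)"
      by (simp add: mult_minus_distrib_mat[of _ n n _ n] minus_mult_distrib_mat[of _ n n _ _ n])
    also have "\<dots> = E + F"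
      unfolding EE FE EF0 FF using EF[THEN carrier_matD(1)] EF[THEN carrier_matD(2)]
      by (intro eq_matI) auto
    finally show "(E - F) * (E - F) = 1\<^sub>m n" using one by simp
    have "(E - F) * X = X * F - X * E"
      using EX FX by (simp add: minus_mult_distrib_mat[of _ n n _ _ n])
    also have "\<dots> = - (X * E - X * F)"
      using carrier_matD[OF X] carrier_matD[OF EF(1)] carrier_matD[OF EF(2)] by (intro eq_matI) auto
    also have "X * E - X * F = X * (E - F)"
      by (simp add: mult_minus_distrib_mat[of _ n n _ n])
    finally show "(E - F) * X = - (X * (E - F))" .
  qed
qed

section \<open>Strong reality of nilpotent matrices\<close>

theorem nilpotent_strongly_Ad_GL_real:
  fixes X :: "'a::division_ring mat"
  assumes X: "X \<in> carrier_mat n n" and "nilpotent_mat X"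
  shows "strongly_Ad_GL_real n X"
proof -
  obtain T where T: "T \<in> carrier_mat n n" "T * T = 1\<^sub>m n" "T * X = - (X * T)"
    using nilpotent_mat_anticommuting_involution[OF assms] .
  interpret G: group "GL n :: 'a mat monoid" by (rule group_GL)
  have TG: "T \<in> carrier (GL n)" using T by (auto simp: GL_simps)
  \<comment> \<open>An involution is its own inverse in the group, so conjugation by
    \<open>T\<close> is \<open>T * X * T\<close>, and anticommutation turns this into
    \<open>- X\<close>.\<close>
  then have "inv\<^bsub>GL n\<^esub> T = T"
    using T(2) by (intro G.inv_equality) (simp_all add: GL_simps)
  then have "Ad n T X = - (X * T) * T" by (simp add: Ad_def T(3))
  also have "\<dots> = - (X * (T * T))"
    using X T(1) by (simp add: assoc_mult_mat[of _ n n _ n _ n])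
  also have "\<dots> = - X" using X T(2) by simp
  finally have "- X = Ad n T X" by simp
  moreover have "T [^]\<^bsub>GL n\<^esub> (2::nat) = \<one>\<^bsub>GL n\<^esub>"
    using T TG by (simp add: numeral_2_eq_2 GL_simps)
  ultimately show ?thesis using TG unfolding strongly_Ad_GL_real_def by blast
qed

theorem proposition4p4:
  fixes n :: nat
  assumes "n > 0"
  shows
    "(\<forall>X :: real mat. X \<in> carrier_mat n n \<longrightarrow> nilpotent_mat X \<longrightarrow> strongly_Ad_GL_real n X) \<and>
     (\<forall>X :: complex mat. X \<in> carrier_mat n n \<longrightarrow> nilpotent_mat X \<longrightarrow> strongly_Ad_GL_real n X) \<and>
     (\<forall>X :: quat mat. X \<in> carrier_mat n n \<longrightarrow> nilpotent_mat X \<longrightarrow> strongly_Ad_GL_real n X)"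
  \<comment> \<open>The reals, the complex numbers and the quaternions are all instances of
    \<open>division_ring\<close>.\<close>
  by (intro conjI allI impI nilpotent_strongly_Ad_GL_real)

end
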